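(* Let $\alpha\ge\omega$ be an infinite ordinal, let $\mathcal{U}$ be a class of $\alpha$-dimensional units, and let $\mathrm{K}$ be a class of cylindric-type algebras of dimension $\alpha$ such that $\mathbf{V}(\mathrm{K})=\mathbf{V}(\{\mathfrak{P}(V):V\in\mathcal{U}\})$. Let $m\ge 1$ be a finite cardinal. Then: (1) If $\mathcal{U}$ supports diagonalization, then $\mathfrak{Fr}_m\mathrm{K}$ is not atomic. (2) If $\mathcal{U}$ requires diagonalization, then (a) $\mathfrak{Fr}_m\mathrm{K}$ contains exactly $2^m$ atoms; (b) all atoms of $\mathfrak{Fr}_m\mathrm{K}$ are zero-dimensional; (c) there is a decomposition $\mathfrak{Fr}_m\mathrm{K}\cong\mathfrak{A}\times\mathfrak{B}$ such that $|A|=2^{2^m}$, $\mathfrak{A}$ is discrete and $\mathfrak{B}$ is atomless. (3) If $\mathcal{U}$ is the class of all $\alpha$-dimensional units, then $\mathfrak{Fr}_{m-1}\mathrm{K}$ is atomless.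
   Context: The signature of cylindric-type algebras of dimension $\alpha$ consists of binary operations $+,\cdot$, unary operations $-$ and $c_i$ ($i\in\alpha$), and constants $0,1,d_{ij}$ ($i,j\in\alpha$). A sequence is a function with domain $\alpha$; an $\alpha$-dimensional unit is a set $V$ of sequences. For a sequence $f$, $f(i/u)$ is the sequence agreeing with $f$ except that its value at $i$ is $u$; write $f\equiv_i g$ iff $g=f(i/u)$ for some $u$. The full algebra over $V$ is $\mathfrak{P}(V)=\langle\mathcal{P}(V),\cup,\cap,\sim,\emptyset,V,C_i,D_{ij}\rangle_{i,j\in\alpha}$ with $D_{ij}=\{f\in V:f(i)=f(j)\}$ and $C_iX=\{f\in V:\exists g\in X\, f\equiv_i g\}$. $\mathbf{V}(\mathrm{L})$ denotes the variety generated by a class $\mathrm{L}$. A class $\mathcal{U}$ of units supports diagonalization iff $V\cup\{f(i/f(j))\}\in\mathcal{U}$ for all $V\in\mathcal{U}$, $f\in V$, $i,j\in\alpha$. $\mathcal{U}$ requires diagonalization iff $\mathcal{U}$ contains a singleton unit and $f(i/f(j))\in V$ for all $V\in\mathcal{U}$, $f\in V$, $i,j\in\alpha$. $\mathfrak{Fr}_n\mathrm{K}$ is the free algebra of $\mathbf{V}(\mathrm{K})$ on $n$ free generators. An element $a$ is zero-dimensional if $c_ia=a$ for all $i$; an algebra is discrete if $c_ia=a$ for all elements $a$ and all $i\in\alpha$. Atoms, atomic, atomless refer to the Boolean reduct.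
   Formalization: (1) also assumes that some sequence in some unit of U is not constant (it fails for U={{f}}, f constant, where Fr_m K is finite); in (3) U is the class of all units over one base with at least two elements, and a large enough base generates the same variety as all units. *)

theory Defs
  imports Main
begin

section \<open>Cylindric-type algebras\<close>

text \<open>
  The dimension is represented by its index set, the type \<open>'i\<close>; the order of an ordinal
  \<open>\<alpha>\<close> does not occur in any of the notions below.
\<close>

record ('a, 'i) cyl_alg =
  ca_univ :: "'a set"
  ca_add :: "'a \<Rightarrow> 'a \<Rightarrow> 'a"
  ca_mul :: "'a \<Rightarrow> 'a \<Rightarrow> 'a"
  ca_neg :: "'a \<Rightarrow> 'a"
  ca_zero :: "'a"
  ca_one :: "'a"
  ca_cyl :: "'i \<Rightarrow> 'a \<Rightarrow> 'a"
  ca_diag :: "'i \<Rightarrow> 'i \<Rightarrow> 'a"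

definition cylindric_type :: "('a, 'i) cyl_alg \<Rightarrow> bool" where
  "cylindric_type A \<longleftrightarrow>
     (\<forall>x\<in>ca_univ A. \<forall>y\<in>ca_univ A. ca_add A x y \<in> ca_univ A \<and> ca_mul A x y \<in> ca_univ A) \<and>
     (\<forall>x\<in>ca_univ A. ca_neg A x \<in> ca_univ A \<and> (\<forall>i. ca_cyl A i x \<in> ca_univ A)) \<and>
     ca_zero A \<in> ca_univ A \<and> ca_one A \<in> ca_univ A \<and> (\<forall>i j. ca_diag A i j \<in> ca_univ A)"

definition ca_hom :: "('a, 'i) cyl_alg \<Rightarrow> ('b, 'i) cyl_alg \<Rightarrow> ('a \<Rightarrow> 'b) \<Rightarrow> bool" where
  "ca_hom A B h \<longleftrightarrow>
     (\<forall>x\<in>ca_univ A. h x \<in> ca_univ B) \<and>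
     (\<forall>x\<in>ca_univ A. \<forall>y\<in>ca_univ A. h (ca_add A x y) = ca_add B (h x) (h y) \<and>
                                      h (ca_mul A x y) = ca_mul B (h x) (h y)) \<and>
     (\<forall>x\<in>ca_univ A. h (ca_neg A x) = ca_neg B (h x) \<and>
                      (\<forall>i. h (ca_cyl A i x) = ca_cyl B i (h x))) \<and>
     h (ca_zero A) = ca_zero B \<and> h (ca_one A) = ca_one B \<and>
     (\<forall>i j. h (ca_diag A i j) = ca_diag B i j)"

definition ca_iso :: "('a, 'i) cyl_alg \<Rightarrow> ('b, 'i) cyl_alg \<Rightarrow> bool" where
  "ca_iso A B \<longleftrightarrow> (\<exists>h. ca_hom A B h \<and> bij_betw h (ca_univ A) (ca_univ B))"

definition ca_prod :: "('a, 'i) cyl_alg \<Rightarrow> ('b, 'i) cyl_alg \<Rightarrow> ('a \<times> 'b, 'i) cyl_alg" where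
  "ca_prod A B =
     \<lparr> ca_univ = ca_univ A \<times> ca_univ B,
       ca_add = (\<lambda>p q. (ca_add A (fst p) (fst q), ca_add B (snd p) (snd q))),
       ca_mul = (\<lambda>p q. (ca_mul A (fst p) (fst q), ca_mul B (snd p) (snd q))),
       ca_neg = (\<lambda>p. (ca_neg A (fst p), ca_neg B (snd p))),
       ca_zero = (ca_zero A, ca_zero B),
       ca_one = (ca_one A, ca_one B),
       ca_cyl = (\<lambda>i p. (ca_cyl A i (fst p), ca_cyl B i (snd p))),
       ca_diag = (\<lambda>i j. (ca_diag A i j, ca_diag B i j)) \<rparr>"

definition ca_le :: "('a, 'i) cyl_alg \<Rightarrow> 'a \<Rightarrow> 'a \<Rightarrow> bool" where
  "ca_le A x y \<longleftrightarrow> ca_add A x y = y"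

definition ca_atom :: "('a, 'i) cyl_alg \<Rightarrow> 'a \<Rightarrow> bool" where
  "ca_atom A a \<longleftrightarrow> a \<in> ca_univ A \<and> a \<noteq> ca_zero A \<and>
     (\<forall>x\<in>ca_univ A. ca_le A x a \<longrightarrow> x = ca_zero A \<or> x = a)"

definition ca_atomic :: "('a, 'i) cyl_alg \<Rightarrow> bool" where
  "ca_atomic A \<longleftrightarrow>
     (\<forall>x\<in>ca_univ A. x \<noteq> ca_zero A \<longrightarrow> (\<exists>a. ca_atom A a \<and> ca_le A a x))"

definition ca_atomless :: "('a, 'i) cyl_alg \<Rightarrow> bool" where
  "ca_atomless A \<longleftrightarrow> (\<nexists>a. ca_atom A a)"

definition zero_dimensional :: "('a, 'i) cyl_alg \<Rightarrow> 'a \<Rightarrow> bool" where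
  "zero_dimensional A a \<longleftrightarrow> (\<forall>i. ca_cyl A i a = a)"

definition ca_discrete :: "('a, 'i) cyl_alg \<Rightarrow> bool" where
  "ca_discrete A \<longleftrightarrow> (\<forall>a\<in>ca_univ A. \<forall>i. ca_cyl A i a = a)"


section \<open>Units and full algebras\<close>

definition seq_equiv :: "'i \<Rightarrow> ('i \<Rightarrow> 'u) \<Rightarrow> ('i \<Rightarrow> 'u) \<Rightarrow> bool" where
  "seq_equiv i f g \<longleftrightarrow> (\<exists>u. g = f(i := u))"

definition full_alg :: "('i \<Rightarrow> 'u) set \<Rightarrow> (('i \<Rightarrow> 'u) set, 'i) cyl_alg" where
  "full_alg V =
     \<lparr> ca_univ = Pow V,
       ca_add = (\<union>),
       ca_mul = (\<inter>),
       ca_neg = (\<lambda>X. V - X),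
       ca_zero = {},
       ca_one = V,
       ca_cyl = (\<lambda>i X. {f \<in> V. \<exists>g\<in>X. seq_equiv i f g}),
       ca_diag = (\<lambda>i j. {f \<in> V. f i = f j}) \<rparr>"

definition supports_diagonalization :: "('i \<Rightarrow> 'u) set set \<Rightarrow> bool" where
  "supports_diagonalization \<U> \<longleftrightarrow>
     (\<forall>V\<in>\<U>. \<forall>f\<in>V. \<forall>i j. V \<union> {f(i := f j)} \<in> \<U>)"

definition requires_diagonalization :: "('i \<Rightarrow> 'u) set set \<Rightarrow> bool" where
  "requires_diagonalization \<U> \<longleftrightarrow>
     (\<exists>f. {f} \<in> \<U>) \<and> (\<forall>V\<in>\<U>. \<forall>f\<in>V. \<forall>i j. f(i := f j) \<in> V)"


section \<open>Terms, varieties and free algebras\<close>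

datatype 'i trm =
    Var nat
  | Add "'i trm" "'i trm"
  | Mul "'i trm" "'i trm"
  | Neg "'i trm"
  | Zero
  | One
  | Cyl 'i "'i trm"
  | Diag 'i 'i

primrec tvars :: "'i trm \<Rightarrow> nat set" where
  "tvars (Var x) = {x}"
| "tvars (Add s t) = tvars s \<union> tvars t"
| "tvars (Mul s t) = tvars s \<union> tvars t"
| "tvars (Neg t) = tvars t"
| "tvars Zero = {}"
| "tvars One = {}"
| "tvars (Cyl i t) = tvars t"
| "tvars (Diag i j) = {}"

primrec teval :: "('a, 'i) cyl_alg \<Rightarrow> (nat \<Rightarrow> 'a) \<Rightarrow> 'i trm \<Rightarrow> 'a" where
  "teval A v (Var x) = v x"
| "teval A v (Add s t) = ca_add A (teval A v s) (teval A v t)"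
| "teval A v (Mul s t) = ca_mul A (teval A v s) (teval A v t)"
| "teval A v (Neg t) = ca_neg A (teval A v t)"
| "teval A v Zero = ca_zero A"
| "teval A v One = ca_one A"
| "teval A v (Cyl i t) = ca_cyl A i (teval A v t)"
| "teval A v (Diag i j) = ca_diag A i j"

definition satisfies :: "('a, 'i) cyl_alg \<Rightarrow> 'i trm \<times> 'i trm \<Rightarrow> bool" where
  "satisfies A e \<longleftrightarrow>
     (\<forall>v. range v \<subseteq> ca_univ A \<longrightarrow> teval A v (fst e) = teval A v (snd e))"

definition identities :: "('a, 'i) cyl_alg set \<Rightarrow> ('i trm \<times> 'i trm) set" where
  "identities L = {e. \<forall>A\<in>L. satisfies A e}"

text \<open>
  A variety is the class of all models of a set of equations, so the variety generated by \<open>L\<close>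
  consists of the models of the identities of \<open>L\<close>.  It is a proper class; \<open>variety L\<close> is its
  part on the carrier type \<open>'c\<close>, which may differ from the carrier type of \<open>L\<close>.
  Two generated varieties coincide as soon as they coincide on the carrier type \<open>'i trm set\<close>,
  see \<open>variety_eq_iff\<close> below.
\<close>

definition variety :: "('a, 'i) cyl_alg set \<Rightarrow> ('c, 'i) cyl_alg set" where
  "variety L = {A. cylindric_type A \<and> (\<forall>e\<in>identities L. satisfies A e)}"

text \<open>
  The free algebra of \<open>variety L\<close> on the generators \<open>X\<close>: the terms with variables in \<open>X\<close>, modulo
  the identities of \<open>L\<close> (equivalently, of \<open>variety L\<close>).
\<close>

definition tclass :: "('a, 'i) cyl_alg set \<Rightarrow> nat set \<Rightarrow> 'i trm \<Rightarrow> 'i trm set" where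
  "tclass L X t = {s. tvars s \<subseteq> X \<and> (s, t) \<in> identities L}"

definition free_over :: "('a, 'i) cyl_alg set \<Rightarrow> nat set \<Rightarrow> ('i trm set, 'i) cyl_alg" where
  "free_over L X =
     \<lparr> ca_univ = tclass L X ` {t. tvars t \<subseteq> X},
       ca_add = (\<lambda>P Q. \<Union>s\<in>P. \<Union>t\<in>Q. tclass L X (Add s t)),
       ca_mul = (\<lambda>P Q. \<Union>s\<in>P. \<Union>t\<in>Q. tclass L X (Mul s t)),
       ca_neg = (\<lambda>P. \<Union>t\<in>P. tclass L X (Neg t)),
       ca_zero = tclass L X Zero,
       ca_one = tclass L X One,
       ca_cyl = (\<lambda>i P. \<Union>t\<in>P. tclass L X (Cyl i t)),
       ca_diag = (\<lambda>i j. tclass L X (Diag i j)) \<rparr>"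

definition free_alg :: "nat \<Rightarrow> ('a, 'i) cyl_alg set \<Rightarrow> ('i trm set, 'i) cyl_alg" where
  "free_alg n L = free_over L {..<n}"


subsection \<open>Basic facts\<close>

lemma cylindric_type_full_alg: "cylindric_type (full_alg V)"
  by (auto simp: cylindric_type_def full_alg_def)

lemma teval_closed:
  assumes "cylindric_type A" "\<forall>x\<in>tvars t. v x \<in> ca_univ A"
  shows "teval A v t \<in> ca_univ A"
  using assms(2) by (induction t) (use assms(1) in \<open>auto simp: cylindric_type_def\<close>)

lemma teval_cong: "\<forall>x\<in>tvars t. v x = w x \<Longrightarrow> teval A v t = teval A w t"
  by (induction t) auto

lemma identities_refl: "(t, t) \<in> identities L"
  by (simp add: identities_def satisfies_def)

lemma identities_sym: "(s, t) \<in> identities L \<Longrightarrow> (t, s) \<in> identities L"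
  by (simp add: identities_def satisfies_def)

lemma identities_trans:
  "(s, t) \<in> identities L \<Longrightarrow> (t, u) \<in> identities L \<Longrightarrow> (s, u) \<in> identities L"
  by (simp add: identities_def satisfies_def)

lemma identities_cong:
  "(s, s') \<in> identities L \<Longrightarrow> (t, t') \<in> identities L \<Longrightarrow> (Add s t, Add s' t') \<in> identities L"
  "(s, s') \<in> identities L \<Longrightarrow> (t, t') \<in> identities L \<Longrightarrow> (Mul s t, Mul s' t') \<in> identities L"
  "(s, s') \<in> identities L \<Longrightarrow> (Neg s, Neg s') \<in> identities L"
  "(s, s') \<in> identities L \<Longrightarrow> (Cyl i s, Cyl i s') \<in> identities L"
  by (simp_all add: identities_def satisfies_def)

lemma tclass_eqI: "(s, t) \<in> identities L \<Longrightarrow> tclass L X s = tclass L X t"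
  unfolding tclass_def by (blast intro: identities_sym identities_trans)

lemma tclass_eq_iff:
  assumes "tvars s \<subseteq> X"
  shows "tclass L X s = tclass L X t \<longleftrightarrow> (s, t) \<in> identities L"
  using assms tclass_eqI[of s t L X] identities_refl[of s L] by (auto simp: tclass_def)

lemma tclass_self: "tvars t \<subseteq> X \<Longrightarrow> t \<in> tclass L X t"
  by (simp add: tclass_def identities_refl)

lemma UN_tclass1:
  assumes "tvars s \<subseteq> X" "\<And>u. (u, s) \<in> identities L \<Longrightarrow> (c u, c s) \<in> identities L"
  shows "(\<Union>u\<in>tclass L X s. tclass L X (c u)) = tclass L X (c s)"
proof -
  have "tclass L X (c u) = tclass L X (c s)" if "u \<in> tclass L X s" for u
    using that assms(2) by (intro tclass_eqI) (simp add: tclass_def)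
  then show ?thesis using tclass_self[OF assms(1), of L] by blast
qed

lemma UN_tclass2:
  assumes "tvars s \<subseteq> X" "tvars t \<subseteq> X"
    "\<And>u w. (u, s) \<in> identities L \<Longrightarrow> (w, t) \<in> identities L \<Longrightarrow> (c u w, c s t) \<in> identities L"
  shows "(\<Union>u\<in>tclass L X s. \<Union>w\<in>tclass L X t. tclass L X (c u w)) = tclass L X (c s t)"
proof -
  have "tclass L X (c u w) = tclass L X (c s t)" if "u \<in> tclass L X s" "w \<in> tclass L X t" for u w
    using that assms(3) by (intro tclass_eqI) (simp add: tclass_def)
  then show ?thesis using tclass_self[OF assms(1), of L] tclass_self[OF assms(2), of L] by blast
qed

lemma free_over_simps:
  "ca_univ (free_over L X) = tclass L X ` {t. tvars t \<subseteq> X}"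
  "tvars s \<subseteq> X \<Longrightarrow> tvars t \<subseteq> X \<Longrightarrow>
     ca_add (free_over L X) (tclass L X s) (tclass L X t) = tclass L X (Add s t)"
  "tvars s \<subseteq> X \<Longrightarrow> tvars t \<subseteq> X \<Longrightarrow>
     ca_mul (free_over L X) (tclass L X s) (tclass L X t) = tclass L X (Mul s t)"
  "tvars s \<subseteq> X \<Longrightarrow> ca_neg (free_over L X) (tclass L X s) = tclass L X (Neg s)"
  "ca_zero (free_over L X) = tclass L X Zero"
  "ca_one (free_over L X) = tclass L X One"
  "tvars s \<subseteq> X \<Longrightarrow> ca_cyl (free_over L X) i (tclass L X s) = tclass L X (Cyl i s)"
  "ca_diag (free_over L X) i j = tclass L X (Diag i j)"
  by (simp_all add: free_over_def UN_tclass1 UN_tclass2 identities_cong)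

lemma cylindric_type_free_over: "cylindric_type (free_over L X)"
proof -
  have img: "tclass L X t \<in> ca_univ (free_over L X)" if "tvars t \<subseteq> X" for t
    using that by (auto simp: free_over_simps(1))
  have ex: "\<exists>t. tvars t \<subseteq> X \<and> P = tclass L X t" if "P \<in> ca_univ (free_over L X)" for P
    using that by (auto simp: free_over_simps(1))
  show ?thesis unfolding cylindric_type_def
    by (force dest!: ex simp: free_over_simps(2-) intro!: img)
qed

primrec tsubst :: "(nat \<Rightarrow> 'i trm) \<Rightarrow> 'i trm \<Rightarrow> 'i trm" where
  "tsubst r (Var x) = r x"
| "tsubst r (Add s t) = Add (tsubst r s) (tsubst r t)"
| "tsubst r (Mul s t) = Mul (tsubst r s) (tsubst r t)"
| "tsubst r (Neg t) = Neg (tsubst r t)"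
| "tsubst r Zero = Zero"
| "tsubst r One = One"
| "tsubst r (Cyl i t) = Cyl i (tsubst r t)"
| "tsubst r (Diag i j) = Diag i j"

lemma teval_tsubst: "teval A v (tsubst r t) = teval A (\<lambda>x. teval A v (r x)) t"
  by (induction t) auto

lemma tvars_tsubst: "(\<forall>x. tvars (r x) \<subseteq> X) \<Longrightarrow> tvars (tsubst r t) \<subseteq> X"
  by (induction t) auto

lemma teval_free_over:
  assumes "\<forall>x. tvars (r x) \<subseteq> X"
  shows "teval (free_over L X) (\<lambda>x. tclass L X (r x)) t = tclass L X (tsubst r t)"
  by (induction t) (simp_all add: free_over_simps(2-) tvars_tsubst[OF assms])

lemma identities_tsubst:
  assumes "\<forall>A\<in>L. cylindric_type A" "(s, t) \<in> identities L"
  shows "(tsubst r s, tsubst r t) \<in> identities L"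
  using assms teval_closed
  by (fastforce simp: identities_def satisfies_def teval_tsubst image_subset_iff)

lemma free_over_in_variety:
  assumes "\<forall>A\<in>L. cylindric_type A"
  shows "free_over L X \<in> variety L"
proof -
  have "teval (free_over L X) v s = teval (free_over L X) v t"
    if st: "(s, t) \<in> identities L" and v: "range v \<subseteq> ca_univ (free_over L X)" for s t v
  proof -
    have "\<forall>x. \<exists>u. tvars u \<subseteq> X \<and> v x = tclass L X u"
      using v unfolding free_over_simps(1) by blast
    then obtain r where r: "\<forall>x. tvars (r x) \<subseteq> X" "v = (\<lambda>x. tclass L X (r x))"
      by (metis ext)
    show ?thesis unfolding r(2) teval_free_over[OF r(1)]
      by (intro tclass_eqI identities_tsubst assms st)
  qed
  then show ?thesis
    by (auto simp: variety_def satisfies_def cylindric_type_free_over)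
qed

text \<open>The universal property; uniqueness holds because the classes of the variables generate.\<close>

lemma free_over_universal:
  fixes A :: "('c, 'i) cyl_alg"
  assumes A: "A \<in> variety L" and v: "\<forall>x\<in>X. v x \<in> ca_univ A"
  shows "\<exists>h. ca_hom (free_over L X) A h \<and> (\<forall>x\<in>X. h (tclass L X (Var x)) = v x)"
proof -
  have ct: "cylindric_type A" using A by (simp add: variety_def)
  then have z: "ca_zero A \<in> ca_univ A" by (simp add: cylindric_type_def)
  define w where "w x = (if x \<in> X then v x else ca_zero A)" for x
  have w: "range w \<subseteq> ca_univ A" using v z by (auto simp: w_def)
  define h where "h P = teval A w (SOME t. t \<in> P)" for P
  have h: "h (tclass L X t) = teval A w t" if "tvars t \<subseteq> X" for t
  proof -
    have "(SOME s. s \<in> tclass L X t) \<in> tclass L X t"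
      using tclass_self[OF that] by (rule someI)
    then have "((SOME s. s \<in> tclass L X t), t) \<in> identities L" by (simp add: tclass_def)
    then show ?thesis using A w by (force simp: h_def variety_def satisfies_def)
  qed
  have "ca_hom (free_over L X) A h"
  proof -
    have ex: "\<exists>t. tvars t \<subseteq> X \<and> P = tclass L X t" if "P \<in> ca_univ (free_over L X)" for P
      using that by (auto simp: free_over_simps(1))
    have cl: "teval A w t \<in> ca_univ A" for t using teval_closed[OF ct] w by blast
    show ?thesis unfolding ca_hom_def
      by (auto dest!: ex simp: free_over_simps(2-) h cl)
  qed
  moreover have "\<forall>x\<in>X. h (tclass L X (Var x)) = v x" by (simp add: h w_def)
  ultimately show ?thesis by blast
qed

lemma identities_eq_of_variety_eq:
  fixes K :: "('a, 'i) cyl_alg set" and L :: "('b, 'i) cyl_alg set"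
  assumes K: "\<forall>A\<in>K. cylindric_type A"
    and eq: "(variety K :: ('i trm set, 'i) cyl_alg set) \<subseteq> variety L"
  shows "identities L \<subseteq> identities K"
proof clarify
  fix s t assume st: "(s, t) \<in> identities L"
  let ?F = "free_over K UNIV"
  have "?F \<in> variety L" using free_over_in_variety[OF K] eq by blast
  then have "satisfies ?F (s, t)" using st by (auto simp: variety_def)
  moreover have "range (\<lambda>x. tclass K UNIV (Var x)) \<subseteq> ca_univ ?F"
    by (auto simp: free_over_simps(1))
  ultimately have "teval ?F (\<lambda>x. tclass K UNIV (Var x)) s = teval ?F (\<lambda>x. tclass K UNIV (Var x)) t"
    by (simp add: satisfies_def)
  moreover have "tsubst Var u = u" for u :: "'i trm" by (induction u) auto
  ultimately show "(s, t) \<in> identities K"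
    by (simp add: teval_free_over tclass_eq_iff)
qed

lemma variety_eq_iff:
  fixes K :: "('a, 'i) cyl_alg set" and L :: "('b, 'i) cyl_alg set"
  assumes "\<forall>A\<in>K. cylindric_type A" "\<forall>A\<in>L. cylindric_type A"
  shows "(variety K :: ('i trm set, 'i) cyl_alg set) = variety L \<longleftrightarrow> identities K = identities L"
proof
  assume "(variety K :: ('i trm set, 'i) cyl_alg set) = variety L"
  then show "identities K = identities L"
    by (intro equalityI identities_eq_of_variety_eq assms) simp_all
qed (simp add: variety_def)

end

theory Submission
  imports Defs
begin

text \<open>
  A term t mentions only finitely many indices, so its truth at a sequence f of a unit V depends only
  on the part of V reached from f by changing those indices; everything outside may be altered.
  If f or a neighbour of f is non-constant, diagonalization at a fresh index k yields a sequence e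
  outside this part, and choosing whether the first generator separates e from its k-neighbour
  splits t.  Hence no atom lies below \<open>c\<^sub>p (- d\<^sub>p\<^sub>q)\<close>, which gives (1) and the atomless factor in (2).
  If diagonalization is required, a sequence in \<open>- c\<^sub>p (- d\<^sub>p\<^sub>q)\<close> is constant and has no neighbours at
  all in its unit, so the terms on m generators are propositional there: the m generators cut this
  element into exactly 2^m atoms.  For (3) every term is split by a diagonal with two fresh indices.
\<close>

section \<open>Points of units and the extension of a term\<close>

lemma seq_equiv_refl: "seq_equiv i f f"
  unfolding seq_equiv_def by (metis fun_upd_triv)

lemma seq_equiv_sym: "seq_equiv i f g \<Longrightarrow> seq_equiv i g f"
  unfolding seq_equiv_def by (metis fun_upd_triv fun_upd_upd)

lemma full_alg_simps [simp]:
  "ca_univ (full_alg V) = Pow V"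
  "ca_add (full_alg V) = (\<union>)"
  "ca_mul (full_alg V) = (\<inter>)"
  "ca_neg (full_alg V) X = V - X"
  "ca_zero (full_alg V) = {}"
  "ca_one (full_alg V) = V"
  "ca_cyl (full_alg V) i X = {f \<in> V. \<exists>g\<in>X. seq_equiv i f g}"
  "ca_diag (full_alg V) i j = {f \<in> V. f i = f j}"
  by (simp_all add: full_alg_def)

lemma teval_full_alg_subset:
  assumes "range v \<subseteq> Pow V"
  shows "teval (full_alg V) v t \<subseteq> V"
  using teval_closed[OF cylindric_type_full_alg, of t v V] assms
  by auto

text \<open>A point is a pointed model: a unit, a valuation of the variables in it and a sequence of
  the unit. Gathering the points of all units turns an identity of the whole class into one equation
  between sets, so that the free algebra is handled as a field of subsets of
  \<open>points U\<close>.\<close>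

definition points ::
    "('i \<Rightarrow> 'u) set set \<Rightarrow> (('i \<Rightarrow> 'u) set \<times> (nat \<Rightarrow> ('i \<Rightarrow> 'u) set) \<times> ('i \<Rightarrow> 'u)) set" where
  "points U = {(V, v, f). V \<in> U \<and> range v \<subseteq> Pow V \<and> f \<in> V}"

definition ext ::
    "('i \<Rightarrow> 'u) set set \<Rightarrow> 'i trm \<Rightarrow> (('i \<Rightarrow> 'u) set \<times> (nat \<Rightarrow> ('i \<Rightarrow> 'u) set) \<times> ('i \<Rightarrow> 'u)) set" where
  "ext U t = {(V, v, f). (V, v, f) \<in> points U \<and> f \<in> teval (full_alg V) v t}"

lemma ext_simps [simp]:
  "ext U (Add s t) = ext U s \<union> ext U t"
  "ext U (Mul s t) = ext U s \<inter> ext U t"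
  "ext U (Neg t) = points U - ext U t"
  "ext U Zero = {}"
  "ext U One = points U"
  by (auto simp: ext_def points_def)

lemma ext_Cyl:
  "(V, v, f) \<in> ext U (Cyl i t) \<longleftrightarrow>
     (V, v, f) \<in> points U \<and> (\<exists>g. (V, v, g) \<in> ext U t \<and> seq_equiv i f g)"
  using teval_full_alg_subset[of v V t] by (auto simp: ext_def points_def)

lemma ext_Diag: "(V, v, f) \<in> ext U (Diag i j) \<longleftrightarrow> (V, v, f) \<in> points U \<and> f i = f j"
  by (auto simp: ext_def points_def)

lemma ext_Var: "(V, v, f) \<in> ext U (Var x) \<longleftrightarrow> (V, v, f) \<in> points U \<and> f \<in> v x"
  by (auto simp: ext_def points_def)

lemma ext_subset_points: "ext U t \<subseteq> points U"
  by (auto simp: ext_def)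

text \<open>The extension, sliced at a fixed unit and valuation, is the value of the term there; so
  comparing extensions compares all values at once.\<close>

lemma identities_iff_ext: "(s, t) \<in> identities (full_alg ` U) \<longleftrightarrow> ext U s = ext U t"
proof
  assume "(s, t) \<in> identities (full_alg ` U)"
  then show "ext U s = ext U t"
    by (auto simp: identities_def satisfies_def ext_def points_def image_subset_iff)
next
  assume eq: "ext U s = ext U t"
  have "teval (full_alg V) v s = teval (full_alg V) v t" if "V \<in> U" "range v \<subseteq> Pow V" for V v
  proof -
    \<comment> \<open>No part of the value is lost in the slice, because values of terms stay inside
      \<open>V\<close>.\<close>
    have "teval (full_alg V) v r = {f. (V, v, f) \<in> ext U r}" for r
      using that teval_full_alg_subset[OF that(2)] by (auto simp: ext_def points_def)
    then show ?thesis using eq by simp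
  qed
  then show "(s, t) \<in> identities (full_alg ` U)"
    by (auto simp: identities_def satisfies_def)
qed


section \<open>The Boolean structure of the free algebra\<close>

lemma free_over_carrierE:
  assumes "P \<in> ca_univ (free_over L X)"
  obtains t where "tvars t \<subseteq> X" "P = tclass L X t"
  using assms by (auto simp: free_over_simps(1))

lemma tclass_in_free_over: "tvars t \<subseteq> X \<Longrightarrow> tclass L X t \<in> ca_univ (free_over L X)"
  by (simp add: free_over_simps(1))

lemma tclass_eq_iff_ext:
  "tvars s \<subseteq> X \<Longrightarrow>
     tclass (full_alg ` U) X s = tclass (full_alg ` U) X t \<longleftrightarrow> ext U s = ext U t"
  by (simp add: tclass_eq_iff identities_iff_ext)

lemma ca_le_free_over:
  assumes "tvars s \<subseteq> X" "tvars t \<subseteq> X"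
  shows "ca_le (free_over (full_alg ` U) X) (tclass (full_alg ` U) X s) (tclass (full_alg ` U) X t)
           \<longleftrightarrow> ext U s \<subseteq> ext U t"
  using assms by (auto simp: ca_le_def free_over_simps tclass_eq_iff_ext)

lemma ca_atom_free_over:
  assumes "tvars t \<subseteq> X"
  shows "ca_atom (free_over (full_alg ` U) X) (tclass (full_alg ` U) X t) \<longleftrightarrow>
           ext U t \<noteq> {} \<and>
           (\<forall>s. tvars s \<subseteq> X \<longrightarrow> ext U s \<subseteq> ext U t \<longrightarrow> ext U s = {} \<or> ext U s = ext U t)"
proof -
  let ?F = "free_over (full_alg ` U) X" and ?c = "tclass (full_alg ` U) X"
  have zero: "?c s = ca_zero ?F \<longleftrightarrow> ext U s = {}" if "tvars s \<subseteq> X" for s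
    using that by (simp add: free_over_simps tclass_eq_iff_ext)
  have "(\<forall>x\<in>ca_univ ?F. ca_le ?F x (?c t) \<longrightarrow> x = ca_zero ?F \<or> x = ?c t) \<longleftrightarrow>
      (\<forall>s. tvars s \<subseteq> X \<longrightarrow> ca_le ?F (?c s) (?c t) \<longrightarrow> ?c s = ca_zero ?F \<or> ?c s = ?c t)"
    by (auto simp: free_over_simps(1))
  also have "\<dots> \<longleftrightarrow>
      (\<forall>s. tvars s \<subseteq> X \<longrightarrow> ext U s \<subseteq> ext U t \<longrightarrow> ext U s = {} \<or> ext U s = ext U t)"
    using assms by (auto simp: ca_le_free_over zero tclass_eq_iff_ext)
  finally show ?thesis
    unfolding ca_atom_def using assms by (simp add: zero tclass_in_free_over)
qed

text \<open>The working form of atomicity: an atom decides every term \<open>s\<close> over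
  \<open>X\<close>, because \<open>Mul t s\<close> lies below it and is thus empty or all of it.
  Refuting that something is an atom then amounts to exhibiting one undecided term.\<close>

lemma ca_atom_free_overE:
  assumes "ca_atom (free_over (full_alg ` U) X) a"
  obtains t where "tvars t \<subseteq> X" "a = tclass (full_alg ` U) X t" "ext U t \<noteq> {}"
    "\<And>s. tvars s \<subseteq> X \<Longrightarrow> ext U t \<subseteq> ext U s \<or> ext U t \<inter> ext U s = {}"
proof -
  obtain t where t: "tvars t \<subseteq> X" "a = tclass (full_alg ` U) X t"
    using assms unfolding ca_atom_def by (meson free_over_carrierE)
  have at: "ext U t \<noteq> {}"
    "\<And>s. tvars s \<subseteq> X \<Longrightarrow> ext U s \<subseteq> ext U t \<Longrightarrow> ext U s = {} \<or> ext U s = ext U t"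
    using assms t by (auto simp: ca_atom_free_over)
  have "ext U t \<subseteq> ext U s \<or> ext U t \<inter> ext U s = {}" if "tvars s \<subseteq> X" for s
    using at(2)[of "Mul t s"] that t(1) by auto
  then show thesis using that t at(1) by blast
qed


section \<open>Bisimulations\<close>

primrec indices :: "'i trm \<Rightarrow> 'i set" where
  "indices (Var x) = {}"
| "indices (Add s t) = indices s \<union> indices t"
| "indices (Mul s t) = indices s \<union> indices t"
| "indices (Neg t) = indices t"
| "indices Zero = {}"
| "indices One = {}"
| "indices (Cyl i t) = insert i (indices t)"
| "indices (Diag i j) = {i, j}"

lemma finite_indices: "finite (indices t)"
  by (induction t) auto

text \<open>The bisimulation argument of modal logic, with \<open>seq_equiv i\<close> as
  accessibility relations. Limiting the conditions to \<open>J\<close> and \<open>Y\<close> is the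
  point: the relation may be blind to everything that \<open>t\<close> does not mention.\<close>

lemma teval_bisimulation:
  assumes v: "range v \<subseteq> Pow V" "range v' \<subseteq> Pow V'"
    and dom: "\<And>f f'. R f f' \<Longrightarrow> f \<in> V \<and> f' \<in> V'"
    and var: "\<And>f f' x. R f f' \<Longrightarrow> x \<in> Y \<Longrightarrow> f \<in> v x \<longleftrightarrow> f' \<in> v' x"
    and diag: "\<And>f f' i j. R f f' \<Longrightarrow> i \<in> J \<Longrightarrow> j \<in> J \<Longrightarrow> f i = f j \<longleftrightarrow> f' i = f' j"
    and zig: "\<And>f f' i g. R f f' \<Longrightarrow> i \<in> J \<Longrightarrow> g \<in> V \<Longrightarrow> seq_equiv i f g \<Longrightarrow>
                \<exists>g'. seq_equiv i f' g' \<and> R g g'"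
    and zag: "\<And>f f' i g'. R f f' \<Longrightarrow> i \<in> J \<Longrightarrow> g' \<in> V' \<Longrightarrow> seq_equiv i f' g' \<Longrightarrow>
                \<exists>g. seq_equiv i f g \<and> R g g'"
    and "R f f'" "indices t \<subseteq> J" "tvars t \<subseteq> Y"
  shows "f \<in> teval (full_alg V) v t \<longleftrightarrow> f' \<in> teval (full_alg V') v' t"
  \<comment> \<open>Only the premises on the pair and on the term vary in the induction; the
    conditions on \<open>R\<close> stay fixed.\<close>
  using assms(8-)
proof (induction t arbitrary: f f')
  case (Cyl i t)
  have i: "i \<in> J" and t: "indices t \<subseteq> J" "tvars t \<subseteq> Y" using Cyl.prems by auto
  show ?case
  proof
    assume "f \<in> teval (full_alg V) v (Cyl i t)"
    then obtain g where g: "g \<in> teval (full_alg V) v t" "seq_equiv i f g" by auto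
    moreover have "g \<in> V" using g(1) teval_full_alg_subset[OF v(1)] by blast
    ultimately obtain g' where "seq_equiv i f' g'" "R g g'" using zig Cyl.prems(1) i by blast
    then show "f' \<in> teval (full_alg V') v' (Cyl i t)"
      using Cyl.IH[OF _ t] g(1) dom[OF Cyl.prems(1)] by auto
  next
    assume "f' \<in> teval (full_alg V') v' (Cyl i t)"
    then obtain g' where g: "g' \<in> teval (full_alg V') v' t" "seq_equiv i f' g'" by auto
    moreover have "g' \<in> V'" using g(1) teval_full_alg_subset[OF v(2)] by blast
    ultimately obtain g where "seq_equiv i f g" "R g g'" using zag Cyl.prems(1) i by blast
    then show "f \<in> teval (full_alg V) v (Cyl i t)"
      using Cyl.IH[OF _ t] g(1) dom[OF Cyl.prems(1)] by auto
  qed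
next
  case (Var x)
  then show ?case using var by simp
next
  case (Neg t)
  then show ?case using dom[OF Neg.prems(1)] by simp
next
  case One
  then show ?case using dom[OF One(1)] by simp
next
  case (Diag i j)
  then show ?case using dom[OF Diag(1)] diag[OF Diag(1), of i j] by simp
qed auto


section \<open>Splitting non-constant points\<close>

text \<open>The outer cylindrification also catches sequences that merely have a
  \<open>p\<close>-neighbour separating \<open>p\<close> from \<open>q\<close>. Hence the negation
  forbids neighbours and not just unequal entries.\<close>

definition nonconst :: "'i \<Rightarrow> 'i \<Rightarrow> 'i trm" where
  "nonconst p q = Cyl p (Neg (Diag p q))"

lemma tvars_nonconst [simp]: "tvars (nonconst p q) = {}"
  by (simp add: nonconst_def)

lemma ext_nonconst:
  "(V, v, f) \<in> ext U (nonconst p q) \<longleftrightarrow>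
     (V, v, f) \<in> points U \<and> (\<exists>g\<in>V. seq_equiv p f g \<and> g p \<noteq> g q)"
  by (auto simp: nonconst_def ext_Cyl ext_Diag points_def)

text \<open>The outer step moves to a \<open>p\<close>-neighbour \<open>g\<close>, which can be
  chosen non-constant; the inner part says that the first generator takes both truth values on the
  \<open>k\<close>-line through \<open>g\<close>.\<close>

definition splitter :: "'i \<Rightarrow> 'i \<Rightarrow> 'i trm" where
  "splitter p k = Cyl p (Mul (Cyl k (Var 0)) (Cyl k (Neg (Var 0))))"

lemma ext_splitter:
  "(V, v, f) \<in> ext U (splitter p k) \<longleftrightarrow> (V, v, f) \<in> points U \<and>
     (\<exists>g\<in>V. seq_equiv p f g \<and> (\<exists>h\<in>V. seq_equiv k g h \<and> h \<in> v 0)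
            \<and> (\<exists>h\<in>V. seq_equiv k g h \<and> h \<notin> v 0))"
  by (auto simp: splitter_def ext_Cyl ext_Var points_def)

text \<open>
  For an index k that is fresh for t, changing coordinate k of a point leads out of the part of the
  unit that t can see.  The generator may therefore be altered freely at the new point, which makes
  the splitter true or false at f without affecting t.
\<close>

lemma splitter_splits:
  fixes U :: "('i \<Rightarrow> 'u) set set"
  assumes inf: "infinite (UNIV :: 'i set)"
    and U: "supports_diagonalization U"
    and f: "(V, v, f) \<in> ext U t" "(V, v, f) \<in> ext U (nonconst p q)"
  shows "\<exists>k. ext U t \<inter> ext U (splitter p k) \<noteq> {} \<and> \<not> ext U t \<subseteq> ext U (splitter p k)"
proof -
  define J where "J = insert p (insert q (indices t))"
  have "finite J" by (simp add: J_def finite_indices)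
  then obtain k where k: "k \<notin> J" using inf ex_new_if_finite by blast
  have V: "V \<in> U" "range v \<subseteq> Pow V" "f \<in> V" "f \<in> teval (full_alg V) v t"
    using f(1) by (auto simp: ext_def points_def)
  obtain g where g: "g \<in> V" "seq_equiv p f g" "g p \<noteq> g q"
    using f(2) by (auto simp: ext_nonconst)
  \<comment> \<open>The entries of \<open>g\<close> at \<open>p\<close> and \<open>q\<close> differ,
    so one of them differs from \<open>g k\<close>. Copying it to \<open>k\<close> gives a
    \<open>k\<close>-neighbour \<open>e\<close> of \<open>g\<close> that diagonalization allows in
    the unit.\<close>
  obtain r where r: "g r \<noteq> g k" using g(3) by metis
  define e where "e = g(k := g r)"
  define V' where "V' = V \<union> {e}"
  have "V' \<in> U" using U V(1) g(1) by (auto simp: supports_diagonalization_def V'_def e_def)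
  have gk: "g k = f k" using g(2) k by (auto simp: seq_equiv_def J_def)
  have ek: "e k \<noteq> f k" using r gk by (simp add: e_def)
  \<comment> \<open>The identity on sequences with entry \<open>f k\<close> at \<open>k\<close> is a
    bisimulation: moves in \<open>J\<close> keep that entry, and \<open>e\<close> has a different
    one, so it is never reached.\<close>
  have same: "(V', v', f) \<in> ext U t"
    if v': "range v' \<subseteq> Pow V'" "\<And>h x. h \<in> V \<Longrightarrow> h k = f k \<Longrightarrow> h \<in> v x \<longleftrightarrow> h \<in> v' x" for v'
  proof -
    have "f \<in> teval (full_alg V) v t \<longleftrightarrow> f \<in> teval (full_alg V') v' t"
    proof (rule teval_bisimulation[where R = "\<lambda>h h'. h = h' \<and> h \<in> V \<and> h k = f k"
          and J = J and Y = UNIV])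
      fix h h' i g'
      assume h: "h = h' \<and> h \<in> V \<and> h k = f k" and i: "i \<in> J" and g': "g' \<in> V'" "seq_equiv i h' g'"
      have "g' k = f k" using h i g'(2) k by (auto simp: seq_equiv_def)
      then have "g' \<in> V" using g'(1) ek by (auto simp: V'_def)
      then show "\<exists>g. seq_equiv i h g \<and> g = g' \<and> g \<in> V \<and> g k = f k"
        using h g'(2) \<open>g' k = f k\<close> by blast
    next
      fix h h' i g'
      assume "h = h' \<and> h \<in> V \<and> h k = f k" "i \<in> J" "g' \<in> V" "seq_equiv i h g'"
      then show "\<exists>g. seq_equiv i h' g \<and> g' = g \<and> g' \<in> V \<and> g' k = f k"
        using k by (auto simp: seq_equiv_def)
    qed (use V v' in \<open>auto simp: V'_def J_def\<close>)
    then show ?thesis using \<open>V' \<in> U\<close> V v'(1) by (auto simp: ext_def points_def V'_def)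
  qed
  \<comment> \<open>Under \<open>v1\<close> every generator takes opposite values at
    \<open>g\<close> and \<open>e\<close>, so the splitter holds at \<open>f\<close> by way of
    \<open>g\<close>. Under \<open>v2\<close> membership ignores coordinate \<open>k\<close>, so the
    splitter holds nowhere. Both agree with \<open>v\<close> where \<open>same\<close> demands
    it.\<close>
  define v1 where "v1 x = (if g \<in> v x then v x - {e} else v x \<union> {e})" for x
  define v2 where "v2 x = {h \<in> V'. h(k := f k) \<in> v x}" for x
  have "v1 x \<subseteq> V'" for x
    using V(2) unfolding v1_def V'_def image_subset_iff by (cases "g \<in> v x") auto
  then have v1: "range v1 \<subseteq> Pow V'" by blast
  have v2: "range v2 \<subseteq> Pow V'" by (auto simp: v2_def)
  have "(V', v1, f) \<in> ext U t"
    using ek by (intro same v1) (auto simp: v1_def)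
  moreover have "(V', v1, f) \<in> ext U (splitter p k)"
  proof -
    have "seq_equiv k g e" by (auto simp: seq_equiv_def e_def)
    moreover have "g \<in> v1 0 \<longleftrightarrow> e \<notin> v1 0" using ek gk by (auto simp: v1_def)
    ultimately have "\<exists>h\<in>V'. seq_equiv k g h \<and> h \<in> v1 0" "\<exists>h\<in>V'. seq_equiv k g h \<and> h \<notin> v1 0"
      using seq_equiv_refl[of k g] g(1) unfolding V'_def by blast+
    then show ?thesis
      using \<open>V' \<in> U\<close> v1 V(3) g unfolding ext_splitter by (auto simp: points_def V'_def)
  qed
  moreover have "(V', v2, f) \<in> ext U t"
    by (intro same v2) (auto simp: v2_def V'_def simp del: fun_upd_apply dest: sym)
  moreover have "(V', v2, f) \<notin> ext U (splitter p k)"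
    by (auto simp: ext_splitter v2_def seq_equiv_def)
  ultimately show ?thesis by blast
qed

text \<open>A common point would make some splitter an undecided term; the splitter lies in the free
  algebra because its only variable is 0.\<close>

lemma atom_const:
  fixes U :: "('i \<Rightarrow> 'u) set set"
  assumes "infinite (UNIV :: 'i set)" "supports_diagonalization U" "0 \<in> X"
    and "tvars t \<subseteq> X" "ca_atom (free_over (full_alg ` U) X) (tclass (full_alg ` U) X t)"
  shows "ext U t \<inter> ext U (nonconst p q) = {}"
proof (rule ccontr)
  assume "ext U t \<inter> ext U (nonconst p q) \<noteq> {}"
  then obtain V v f where "(V, v, f) \<in> ext U t" "(V, v, f) \<in> ext U (nonconst p q)" by auto
  then obtain k where k: "ext U t \<inter> ext U (splitter p k) \<noteq> {}" "\<not> ext U t \<subseteq> ext U (splitter p k)"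
    using splitter_splits[OF assms(1,2)] by metis
  obtain t' where "tvars t' \<subseteq> X" "tclass (full_alg ` U) X t = tclass (full_alg ` U) X t'"
    "\<And>s. tvars s \<subseteq> X \<Longrightarrow> ext U t' \<subseteq> ext U s \<or> ext U t' \<inter> ext U s = {}"
    using assms(5) by (rule ca_atom_free_overE) metis
  then have "ext U t \<subseteq> ext U (splitter p k) \<or> ext U t \<inter> ext U (splitter p k) = {}"
    using assms(3,4) by (simp add: tclass_eq_iff_ext splitter_def)
  with k show False by blast
qed

text \<open>The sequence \<open>f\<close> makes \<open>nonconst p q\<close> a nonzero element, and
  by \<open>atom_const\<close> no atom lies below it.\<close>

lemma not_atomic_if_supports:
  fixes U :: "('i \<Rightarrow> 'u) set set"
  assumes "infinite (UNIV :: 'i set)" "supports_diagonalization U" "0 \<in> X"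
    and V: "V \<in> U" "f \<in> V" "f p \<noteq> f q"
  shows "\<not> ca_atomic (free_over (full_alg ` U) X)"
proof
  let ?F = "free_over (full_alg ` U) X"
  assume at: "ca_atomic ?F"
  have "(V, \<lambda>_. {}, f) \<in> ext U (nonconst p q)"
    using V seq_equiv_refl[of p f] by (auto simp: ext_nonconst points_def)
  then have "tclass (full_alg ` U) X (nonconst p q) \<noteq> ca_zero ?F"
    by (auto simp: free_over_simps tclass_eq_iff_ext)
  then obtain a where a: "ca_atom ?F a" "ca_le ?F a (tclass (full_alg ` U) X (nonconst p q))"
    using at tclass_in_free_over[of "nonconst p q" X] unfolding ca_atomic_def by auto
  then obtain t where t: "tvars t \<subseteq> X" "a = tclass (full_alg ` U) X t" "ext U t \<noteq> {}"
    by (elim ca_atom_free_overE)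
  moreover have "ext U t \<subseteq> ext U (nonconst p q)"
    using a(2) t by (simp add: ca_le_free_over)
  moreover have "ext U t \<inter> ext U (nonconst p q) = {}"
    using assms(1-3) a(1) t by (intro atom_const) auto
  ultimately show False by blast
qed

text \<open>Since every set of sequences is a unit, a point of \<open>t\<close> can be moved to a
  unit whose coordinates outside \<open>indices t\<close> are completely free. There a diagonal with
  fresh indices is undecided. This diagonal contains no variables, so the argument covers the free
  algebra without generators.\<close>

lemma atomless_if_all_units:
  assumes inf: "infinite (UNIV :: 'i set)" and xy: "(x :: 'u) \<noteq> y"
  shows "ca_atomless (free_over (full_alg ` (UNIV :: ('i \<Rightarrow> 'u) set set)) X)"
  unfolding ca_atomless_def
proof
  let ?U = "UNIV :: ('i \<Rightarrow> 'u) set set"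
  assume "\<exists>a. ca_atom (free_over (full_alg ` ?U) X) a"
  then obtain a where "ca_atom (free_over (full_alg ` ?U) X) a" by blast
  then obtain t where t: "tvars t \<subseteq> X" "ext ?U t \<noteq> {}"
    "\<And>s. tvars s \<subseteq> X \<Longrightarrow> ext ?U t \<subseteq> ext ?U s \<or> ext ?U t \<inter> ext ?U s = {}"
    by (rule ca_atom_free_overE) metis
  then obtain V v f where "(V, v, f) \<in> ext ?U t" by auto
  then have f: "range v \<subseteq> Pow V" "f \<in> V" "f \<in> teval (full_alg V) v t"
    by (auto simp: ext_def points_def)
  define J where "J = indices t"
  have J: "finite J" by (simp add: J_def finite_indices)
  then obtain k where k: "k \<notin> J" using inf ex_new_if_finite by blast
  obtain l where l: "l \<notin> insert k J" using inf J ex_new_if_finite by (metis finite_insert)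
  \<comment> \<open>\<open>\<psi>\<close> resets the coordinates outside \<open>J\<close> to those
    of \<open>f\<close>. Unit and valuation are pulled back along it, and its graph is then a
    bisimulation for the indices in \<open>J\<close>.\<close>
  define \<psi> where "\<psi> g = (\<lambda>i. if i \<in> J then g i else f i)" for g :: "'i \<Rightarrow> 'u"
  define V' where "V' = {g. \<psi> g \<in> V}"
  define v' where "v' x = {g. \<psi> g \<in> v x}" for x
  have v': "range v' \<subseteq> Pow V'" using f(1) by (auto simp: v'_def V'_def)
  have same: "(V', v', g) \<in> ext ?U t" if g: "\<psi> g = f" for g
  proof -
    have "f \<in> teval (full_alg V) v t \<longleftrightarrow> g \<in> teval (full_alg V') v' t"
    proof (rule teval_bisimulation[where R = "\<lambda>h h'. h = \<psi> h' \<and> h' \<in> V'" and J = J and Y = UNIV])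
      fix h h' i g'
      assume h: "h = \<psi> h' \<and> h' \<in> V'" "i \<in> J" "g' \<in> V" "seq_equiv i h g'"
      then obtain u where u: "g' = h(i := u)" by (auto simp: seq_equiv_def)
      have "g' = \<psi> (h'(i := u))" using h u by (auto simp: \<psi>_def)
      then show "\<exists>g. seq_equiv i h' g \<and> g' = \<psi> g \<and> g \<in> V'"
        using h(3) by (auto simp: seq_equiv_def V'_def)
    next
      fix h h' i g'
      assume h: "h = \<psi> h' \<and> h' \<in> V'" "i \<in> J" "g' \<in> V'" "seq_equiv i h' g'"
      then obtain u where u: "g' = h'(i := u)" by (auto simp: seq_equiv_def)
      have "\<psi> g' = h(i := u)" using h u by (auto simp: \<psi>_def)
      then show "\<exists>g. seq_equiv i h g \<and> g = \<psi> g' \<and> g' \<in> V'"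
        using h(3) by (auto simp: seq_equiv_def)
    qed (use f v' g in \<open>auto simp: V'_def v'_def J_def \<psi>_def\<close>)
    then show ?thesis using f v' g by (auto simp: ext_def points_def V'_def)
  qed
  \<comment> \<open>Both choices of \<open>z\<close> are reset to \<open>f\<close>, hence satisfy
    \<open>t\<close>; \<open>z = x\<close> lies on the diagonal and \<open>z = y\<close> off
    it.\<close>
  have psi: "\<psi> (f(k := x, l := z)) = f" for z using k l by (auto simp: \<psi>_def)
  have "(V', v', f(k := x, l := x)) \<in> ext ?U (Diag k l)"
    using same[OF psi, of x] l by (auto simp: ext_Diag ext_def points_def)
  moreover have "(V', v', f(k := x, l := y)) \<notin> ext ?U (Diag k l)"
    using xy l by (auto simp: ext_Diag)
  ultimately show False using t(3)[of "Diag k l"] same[OF psi] by auto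
qed


section \<open>Isolated points\<close>

lemma supports_if_requires: "requires_diagonalization U \<Longrightarrow> supports_diagonalization U"
  by (auto simp: requires_diagonalization_def supports_diagonalization_def insert_absorb)

lemma requires_diagonalizationD:
  "requires_diagonalization U \<Longrightarrow> V \<in> U \<Longrightarrow> f \<in> V \<Longrightarrow> f(i := f j) \<in> V"
  by (simp add: requires_diagonalization_def)

definition isolated :: "'i \<Rightarrow> 'i \<Rightarrow> 'i trm" where
  "isolated p q = Neg (nonconst p q)"

lemma tvars_isolated [simp]: "tvars (isolated p q) = {}"
  by (simp add: isolated_def)

text \<open>
  Isolation in direction p gives isolation in every direction i: if \<open>f(i := u)\<close> is in the unit, then so
  is \<open>f(p := u)\<close>, by copying the value u to p and restoring coordinate i from a third index.
\<close>

lemma ext_isolatedD: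
  fixes U :: "('i \<Rightarrow> 'u) set set"
  assumes inf: "infinite (UNIV :: 'i set)"
    and U: "requires_diagonalization U" and pq: "p \<noteq> q"
    and f: "(V, v, f) \<in> ext U (isolated p q)"
  shows "f i = f j" and "g \<in> V \<Longrightarrow> seq_equiv i f g \<Longrightarrow> g = f"
proof -
  have V: "V \<in> U" "f \<in> V" using f by (auto simp: isolated_def points_def)
  note cl = requires_diagonalizationD[OF U V(1)]
  have iso: "u = f q" if "f(p := u) \<in> V" for u
  proof (rule ccontr)
    assume "u \<noteq> f q"
    then have "seq_equiv p f (f(p := u))" "(f(p := u)) p \<noteq> (f(p := u)) q"
      using pq by (auto simp: seq_equiv_def)
    then have "(V, v, f) \<in> ext U (nonconst p q)"
      using f that unfolding ext_nonconst isolated_def ext_simps(3) by blast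
    then show False using f by (simp add: isolated_def)
  qed
  \<comment> \<open>Diagonalization puts \<open>f(p := f j)\<close> into the unit, so
    \<open>iso\<close> applies with \<open>u = f j\<close>.\<close>
  have const: "f j = f q" for j using iso[OF cl[OF V(2)]] .
  show "f i = f j" using const by metis
  assume g: "g \<in> V" "seq_equiv i f g"
  then obtain u where u: "g = f(i := u)" by (auto simp: seq_equiv_def)
  have "f(p := u) \<in> V"
  proof (cases "i = p")
    case False
    define h where "h = g(p := g i)"
    obtain j where j: "j \<noteq> i" "j \<noteq> p"
      using ex_new_if_finite[OF inf, of "{i, p}"] by auto
    have "h(i := h j) \<in> V" using cl[OF cl[OF g(1)]] by (simp add: h_def)
    moreover have "h(i := h j) = f(p := u)"
      using j False const[of i] const[of j] u by (auto simp: h_def fun_eq_iff)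
    ultimately show ?thesis by simp
  qed (use g u in simp)
  then have "u = f i" using iso const by metis
  then show "g = f" using u by simp
qed

text \<open>Both sequences are constant and have only themselves as neighbours, so the single pair
  \<open>(f, f')\<close> is a bisimulation for all indices: every diagonal holds, every move is
  trivial, and only the variables can tell the points apart.\<close>

lemma isolated_determined:
  fixes U :: "('i \<Rightarrow> 'u) set set"
  assumes inf: "infinite (UNIV :: 'i set)" and U: "requires_diagonalization U" and pq: "p \<noteq> q"
    and f: "(V, v, f) \<in> ext U (isolated p q)" "(V', v', f') \<in> ext U (isolated p q)"
    and var: "\<And>x. x \<in> tvars t \<Longrightarrow> f \<in> v x \<longleftrightarrow> f' \<in> v' x"
  shows "(V, v, f) \<in> ext U t \<longleftrightarrow> (V', v', f') \<in> ext U t"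
proof -
  note iso = ext_isolatedD[OF inf U pq f(1)] ext_isolatedD[OF inf U pq f(2)]
  have p: "(V, v, f) \<in> points U" "(V', v', f') \<in> points U"
    using f by (auto simp: isolated_def)
  have "f \<in> teval (full_alg V) v t \<longleftrightarrow> f' \<in> teval (full_alg V') v' t"
  proof (rule teval_bisimulation[where R = "\<lambda>h h'. h = f \<and> h' = f'" and J = UNIV and Y = "tvars t"])
    fix h h' i j
    assume "h = f \<and> h' = f'"
    then show "h i = h j \<longleftrightarrow> h' i = h' j" using iso(1)[of i j] iso(3)[of i j] by simp
  next
    fix h h' i g
    assume "h = f \<and> h' = f'" "g \<in> V" "seq_equiv i h g"
    then show "\<exists>g'. seq_equiv i h' g' \<and> g = f \<and> g' = f'"
      using iso(2) seq_equiv_refl by metis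
  next
    fix h h' i g'
    assume "h = f \<and> h' = f'" "g' \<in> V'" "seq_equiv i h' g'"
    then show "\<exists>g. seq_equiv i h g \<and> g = f \<and> g' = f'"
      using iso(4) seq_equiv_refl by metis
  qed (use p var in \<open>auto simp: points_def\<close>)
  then show ?thesis using p by (simp add: ext_def)
qed

text \<open>A point whose \<open>i\<close>-neighbour is isolated coincides with that neighbour, so
  cylindrification adds nothing.\<close>

lemma isolated_zero_dim:
  fixes U :: "('i \<Rightarrow> 'u) set set"
  assumes inf: "infinite (UNIV :: 'i set)" and U: "requires_diagonalization U" and pq: "p \<noteq> q"
    and "ext U t \<subseteq> ext U (isolated p q)"
  shows "ext U (Cyl i t) = ext U t"
proof -
  have "(V, v, f) \<in> ext U (Cyl i t) \<longleftrightarrow> (V, v, f) \<in> ext U t" for V v f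
  proof
    assume "(V, v, f) \<in> ext U (Cyl i t)"
    then obtain g where g: "(V, v, f) \<in> points U" "(V, v, g) \<in> ext U t" "seq_equiv i f g"
      by (auto simp: ext_Cyl)
    then have "f = g"
      using ext_isolatedD(2)[OF inf U pq, of V v g f i] assms(4) seq_equiv_sym[of i f g]
      by (auto simp: points_def)
    then show "(V, v, f) \<in> ext U t" using g by simp
  next
    assume "(V, v, f) \<in> ext U t"
    then show "(V, v, f) \<in> ext U (Cyl i t)"
      using seq_equiv_refl[of i f] ext_subset_points[of U t] by (auto simp: ext_Cyl)
  qed
  then show ?thesis by auto
qed

section \<open>Cells: isolated points sorted by the generators they satisfy\<close>

primrec literals :: "nat set \<Rightarrow> nat \<Rightarrow> 'i trm" where
  "literals S 0 = One"
| "literals S (Suc n) = Mul (if n \<in> S then Var n else Neg (Var n)) (literals S n)"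

lemma tvars_literals: "tvars (literals S n) = {..<n}"
  by (induction n) (simp_all add: lessThan_Suc)

lemma ext_literals:
  "(V, v, f) \<in> ext U (literals S n) \<longleftrightarrow>
     (V, v, f) \<in> points U \<and> (\<forall>x<n. f \<in> v x \<longleftrightarrow> x \<in> S)"
proof (induction n)
  case (Suc n)
  then show ?case by (cases "n \<in> S") (auto simp: ext_Var All_less_Suc)
qed simp

text \<open>The propositional minterm with sign pattern \<open>S\<close>, cut down to the isolated
  points. These are the future atoms.\<close>

definition cell :: "nat \<Rightarrow> 'i \<Rightarrow> 'i \<Rightarrow> nat set \<Rightarrow> 'i trm" where
  "cell n p q S = Mul (literals S n) (isolated p q)"

lemma tvars_cell [simp]: "tvars (cell n p q S) = {..<n}"
  by (simp add: cell_def tvars_literals)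

lemma ext_cell:
  "(V, v, f) \<in> ext U (cell n p q S) \<longleftrightarrow>
     (V, v, f) \<in> ext U (isolated p q) \<and> (\<forall>x<n. f \<in> v x \<longleftrightarrow> x \<in> S)"
  using ext_subset_points[of U "isolated p q"] by (auto simp: cell_def ext_literals)

lemma ext_cell_subset: "ext U (cell n p q S) \<subseteq> ext U (isolated p q)"
  by (auto simp: cell_def)

text \<open>In a singleton unit \<open>{f}\<close> diagonalization forces \<open>f p = f q\<close>,
  and \<open>f\<close> has no other neighbour, so it is isolated. Each variable can be made true or
  false at \<open>f\<close> at will, as \<open>S\<close> prescribes.\<close>

lemma ext_cell_nonempty:
  assumes "requires_diagonalization U"
  shows "ext U (cell n p q S) \<noteq> {}"
proof -
  obtain f where f: "{f} \<in> U"
    using conjunct1[OF assms[unfolded requires_diagonalization_def]] by (rule exE)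
  have "f(p := f q) \<in> {f}"
    using requires_diagonalizationD[OF assms f singletonI] .
  then have "f p = f q" by (metis fun_upd_same singletonD)
  then have "({f}, \<lambda>x. if x \<in> S then {f} else {}, f) \<in> ext U (cell n p q S)"
    using f by (simp add: ext_cell isolated_def ext_nonconst points_def image_subset_iff)
  then show ?thesis by blast
qed

lemma cells_meet_iff:
  assumes "requires_diagonalization U" "S \<subseteq> {..<n}" "T \<subseteq> {..<n}"
  shows "ext U (cell n p q S) \<inter> ext U (cell n p q T) \<noteq> {} \<longleftrightarrow> S = T"
proof
  assume "ext U (cell n p q S) \<inter> ext U (cell n p q T) \<noteq> {}"
  then obtain V v f where "(V, v, f) \<in> ext U (cell n p q S)" "(V, v, f) \<in> ext U (cell n p q T)"
    by auto
  then have "x \<in> S \<longleftrightarrow> x \<in> T" if "x < n" for x using that by (auto simp: ext_cell)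
  then show "S = T" using assms(2,3) by auto
qed (use ext_cell_nonempty[OF assms(1)] in simp)

section \<open>Relativization to a zero-dimensional element\<close>

text \<open>The carrier type is kept, so the factors of the free algebra again consist of classes of
  terms.\<close>

definition relativize :: "('a, 'i) cyl_alg \<Rightarrow> 'a \<Rightarrow> ('a, 'i) cyl_alg" where
  "relativize A d =
     \<lparr> ca_univ = ca_mul A d ` ca_univ A,
       ca_add = ca_add A,
       ca_mul = ca_mul A,
       ca_neg = (\<lambda>x. ca_mul A d (ca_neg A x)),
       ca_zero = ca_zero A,
       ca_one = d,
       ca_cyl = (\<lambda>i x. ca_mul A d (ca_cyl A i x)),
       ca_diag = (\<lambda>i j. ca_mul A d (ca_diag A i j)) \<rparr>"

lemma relativize_simps [simp]:
  "ca_add (relativize A d) = ca_add A"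
  "ca_mul (relativize A d) = ca_mul A"
  "ca_neg (relativize A d) x = ca_mul A d (ca_neg A x)"
  "ca_zero (relativize A d) = ca_zero A"
  "ca_one (relativize A d) = d"
  "ca_cyl (relativize A d) i x = ca_mul A d (ca_cyl A i x)"
  "ca_diag (relativize A d) i j = ca_mul A d (ca_diag A i j)"
  by (simp_all add: relativize_def)

text \<open>Being fixed by all cylindrifications means that no step to a neighbour inside the unit
  enters or leaves \<open>d\<close>. Witnesses for a cylindrification therefore lie on the same side
  of \<open>d\<close> as the point itself.\<close>

lemma ext_Cyl_zero_dim:
  assumes "\<And>i. ext U (Cyl i d) = ext U d"
  shows "ext U d \<inter> ext U (Cyl i (Mul d t)) = ext U d \<inter> ext U (Cyl i t)"
    and "(points U - ext U d) \<inter> ext U (Cyl i (Mul (Neg d) t)) = (points U - ext U d) \<inter> ext U (Cyl i t)"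
proof -
  have d: "(V, v, f) \<in> ext U d"
    if "(V, v, g) \<in> ext U d" "(V, v, f) \<in> points U" "seq_equiv i f g" for V v f g
  proof -
    have "(V, v, f) \<in> ext U (Cyl i d)" using that by (auto simp: ext_Cyl)
    then show ?thesis using assms by simp
  qed
  have "P \<in> ext U d \<inter> ext U (Cyl i (Mul d t)) \<longleftrightarrow> P \<in> ext U d \<inter> ext U (Cyl i t)" for P
  proof -
    obtain V v f where P: "P = (V, v, f)" by (cases P)
    show ?thesis
      using d[of V v f] ext_subset_points[of U t] seq_equiv_sym[of i f]
      unfolding P Int_iff ext_Cyl ext_simps(2) by blast
  qed
  then show "ext U d \<inter> ext U (Cyl i (Mul d t)) = ext U d \<inter> ext U (Cyl i t)" by blast
  have "P \<in> (points U - ext U d) \<inter> ext U (Cyl i (Mul (Neg d) t)) \<longleftrightarrow>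
      P \<in> (points U - ext U d) \<inter> ext U (Cyl i t)" for P
  proof -
    obtain V v f where P: "P = (V, v, f)" by (cases P)
    show ?thesis
      using d[of V v _ f] ext_subset_points[of U t]
      unfolding P Int_iff Diff_iff ext_Cyl ext_simps(2,3) by blast
  qed
  then show "(points U - ext U d) \<inter> ext U (Cyl i (Mul (Neg d) t)) =
      (points U - ext U d) \<inter> ext U (Cyl i t)" by blast
qed

context
  fixes U :: "('i \<Rightarrow> 'u) set set" and X :: "nat set"
begin

abbreviation (input) "FX \<equiv> free_over (full_alg ` U) X"
abbreviation (input) "clX \<equiv> tclass (full_alg ` U) X"

lemma relativize_univ:
  assumes "tvars d \<subseteq> X"
  shows "ca_univ (relativize FX (clX d)) = clX ` {t. tvars t \<subseteq> X \<and> ext U t \<subseteq> ext U d}"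
proof (intro subset_antisym subsetI)
  fix P
  assume "P \<in> ca_univ (relativize FX (clX d))"
  then obtain t where t: "tvars t \<subseteq> X" "P = ca_mul FX (clX d) (clX t)"
    by (auto simp: relativize_def free_over_simps(1))
  have "P = clX (Mul d t)" using t assms by (simp add: free_over_simps)
  then show "P \<in> clX ` {t. tvars t \<subseteq> X \<and> ext U t \<subseteq> ext U d}"
    using t(1) assms by (intro image_eqI[of _ _ "Mul d t"]) auto
next
  fix P
  assume "P \<in> clX ` {t. tvars t \<subseteq> X \<and> ext U t \<subseteq> ext U d}"
  then obtain t where t: "tvars t \<subseteq> X" "ext U t \<subseteq> ext U d" "P = clX t" by blast
  then have "P = ca_mul FX (clX d) (clX t)"
    using assms by (simp add: free_over_simps tclass_eq_iff_ext Int_absorb1)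
  then show "P \<in> ca_univ (relativize FX (clX d))"
    using t(1) by (simp add: relativize_def tclass_in_free_over)
qed

lemma relativize_univI:
  "tvars d \<subseteq> X \<Longrightarrow> tvars t \<subseteq> X \<Longrightarrow> ext U t \<subseteq> ext U d \<Longrightarrow> clX t \<in> ca_univ (relativize FX (clX d))"
  by (auto simp: relativize_univ)

lemma relativize_univE:
  assumes "tvars d \<subseteq> X" "P \<in> ca_univ (relativize FX (clX d))"
  obtains t where "tvars t \<subseteq> X" "ext U t \<subseteq> ext U d" "P = clX t"
  using assms by (auto simp: relativize_univ)

lemma cylindric_type_relativize:
  assumes d: "tvars d \<subseteq> X"
  shows "cylindric_type (relativize FX (clX d))"
  unfolding cylindric_type_def
proof (intro conjI ballI allI)
  fix P Q
  assume P: "P \<in> ca_univ (relativize FX (clX d))" and Q: "Q \<in> ca_univ (relativize FX (clX d))"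
  obtain s where s: "tvars s \<subseteq> X" "ext U s \<subseteq> ext U d" "P = clX s" using P by (rule relativize_univE[OF d])
  obtain t where t: "tvars t \<subseteq> X" "ext U t \<subseteq> ext U d" "Q = clX t" using Q by (rule relativize_univE[OF d])
  show "ca_add (relativize FX (clX d)) P Q \<in> ca_univ (relativize FX (clX d))"
    using s t d by (simp add: free_over_simps relativize_univI le_infI1)
  show "ca_mul (relativize FX (clX d)) P Q \<in> ca_univ (relativize FX (clX d))"
    using s t d by (simp add: free_over_simps relativize_univI le_infI1)
next
  fix P i
  assume P: "P \<in> ca_univ (relativize FX (clX d))"
  obtain s where s: "tvars s \<subseteq> X" "ext U s \<subseteq> ext U d" "P = clX s" using P by (rule relativize_univE[OF d])
  show "ca_neg (relativize FX (clX d)) P \<in> ca_univ (relativize FX (clX d))"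
    using s d by (simp add: free_over_simps relativize_univI)
  show "ca_cyl (relativize FX (clX d)) i P \<in> ca_univ (relativize FX (clX d))"
    using s d by (simp add: free_over_simps relativize_univI)
qed (use d in \<open>simp_all add: free_over_simps relativize_univI\<close>)

text \<open>The relativized carrier is closed downwards, so an element has the same elements below
  it in both algebras.\<close>

lemma ca_atom_relativize:
  assumes d: "tvars d \<subseteq> X" and a: "ca_atom (relativize FX (clX d)) a"
  shows "ca_atom FX a" "ca_le FX a (clX d)"
proof -
  have "a \<in> ca_univ (relativize FX (clX d))" using a by (simp add: ca_atom_def)
  then obtain t where t: "tvars t \<subseteq> X" "ext U t \<subseteq> ext U d" "a = clX t"
    by (rule relativize_univE[OF d])
  then show "ca_le FX a (clX d)" using d by (simp add: ca_le_free_over)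
  show "ca_atom FX a" unfolding ca_atom_def
  proof (intro conjI ballI impI)
    show "a \<in> ca_univ FX" using t by (simp add: tclass_in_free_over)
    show "a \<noteq> ca_zero FX" using a by (simp add: ca_atom_def)
    fix x
    assume x: "x \<in> ca_univ FX" "ca_le FX x a"
    obtain s where s: "tvars s \<subseteq> X" "x = clX s" using x(1) by (rule free_over_carrierE)
    then have "ext U s \<subseteq> ext U d" using x(2) t by (auto simp: ca_le_free_over)
    then have "x \<in> ca_univ (relativize FX (clX d))" using d s by (auto intro: relativize_univI)
    moreover have "ca_le (relativize FX (clX d)) x a" using x(2) by (simp add: ca_le_def)
    ultimately show "x = ca_zero FX \<or> x = a" using a by (simp add: ca_atom_def)
  qed
qed

text \<open>The Boolean splitting of an element into its parts inside and outside \<open>d\<close>.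
  Zero-dimensionality is what makes it respect cylindrifications.\<close>

lemma ca_iso_relativize:
  assumes d: "tvars d \<subseteq> X" and zd: "\<And>i. ext U (Cyl i d) = ext U d"
  shows "ca_iso FX (ca_prod (relativize FX (clX d)) (relativize FX (clX (Neg d))))"
proof -
  define h where "h P = (ca_mul FX (clX d) P, ca_mul FX (clX (Neg d)) P)" for P
  have h: "h (clX t) = (clX (Mul d t), clX (Mul (Neg d) t))" if "tvars t \<subseteq> X" for t
    using that d by (simp add: h_def free_over_simps)
  let ?A = "relativize FX (clX d)" and ?B = "relativize FX (clX (Neg d))"
  have in_prod: "h P \<in> ca_univ (ca_prod ?A ?B)" if P: "P \<in> ca_univ FX" for P
  proof -
    obtain t where "tvars t \<subseteq> X" "P = clX t" using P by (rule free_over_carrierE)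
    then show ?thesis using d by (simp add: h ca_prod_def relativize_univI)
  qed
  have "ca_hom FX (ca_prod ?A ?B) h"
    unfolding ca_hom_def
  proof (intro conjI ballI allI)
    fix P Q
    assume P: "P \<in> ca_univ FX" and Q: "Q \<in> ca_univ FX"
    obtain s where s: "tvars s \<subseteq> X" "P = clX s" using P by (rule free_over_carrierE)
    obtain t where t: "tvars t \<subseteq> X" "Q = clX t" using Q by (rule free_over_carrierE)
    show "h (ca_add FX P Q) = ca_add (ca_prod ?A ?B) (h P) (h Q)"
      using s t d by (simp add: h ca_prod_def free_over_simps tclass_eq_iff_ext; blast?)
    show "h (ca_mul FX P Q) = ca_mul (ca_prod ?A ?B) (h P) (h Q)"
      using s t d by (simp add: h ca_prod_def free_over_simps tclass_eq_iff_ext; blast?)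
  next
    fix P i
    assume P: "P \<in> ca_univ FX"
    obtain s where s: "tvars s \<subseteq> X" "P = clX s" using P by (rule free_over_carrierE)
    show "h (ca_neg FX P) = ca_neg (ca_prod ?A ?B) (h P)"
      using s d by (simp add: h ca_prod_def free_over_simps tclass_eq_iff_ext; blast?)
    \<comment> \<open>In a factor the cylindrification acts on the part already cut down to that
      factor; \<open>ext_Cyl_zero_dim\<close> removes this inner cut.\<close>
    have "ext U (Mul d (Cyl i s)) = ext U (Mul d (Cyl i (Mul d s)))"
      using ext_Cyl_zero_dim(1)[OF zd, where t = s] unfolding ext_simps(2)[of U d] by blast
    moreover have "ext U (Mul (Neg d) (Cyl i s)) = ext U (Mul (Neg d) (Cyl i (Mul (Neg d) s)))"
      using ext_Cyl_zero_dim(2)[OF zd, where t = s]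
      unfolding ext_simps(2)[of U "Neg d"] ext_simps(3)[of U d] by blast
    ultimately show "h (ca_cyl FX i P) = ca_cyl (ca_prod ?A ?B) i (h P)"
      using s d by (simp add: h ca_prod_def free_over_simps tclass_eq_iff_ext del: ext_simps)
  next
    show "h (ca_zero FX) = ca_zero (ca_prod ?A ?B)" "h (ca_one FX) = ca_one (ca_prod ?A ?B)"
      using d ext_subset_points[of U d]
      by (simp_all add: h ca_prod_def free_over_simps tclass_eq_iff_ext Int_absorb2)
    show "h (ca_diag FX i j) = ca_diag (ca_prod ?A ?B) i j" for i j
      using d by (simp add: h ca_prod_def free_over_simps tclass_eq_iff_ext)
  qed (rule in_prod)
  moreover have "bij_betw h (ca_univ FX) (ca_univ (ca_prod ?A ?B))"
  proof (rule bij_betw_imageI)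
    show "inj_on h (ca_univ FX)"
    proof (rule inj_onI)
      fix P Q
      assume P: "P \<in> ca_univ FX" and Q: "Q \<in> ca_univ FX" and eq: "h P = h Q"
      obtain s where s: "tvars s \<subseteq> X" "P = clX s" using P by (rule free_over_carrierE)
      obtain t where t: "tvars t \<subseteq> X" "Q = clX t" using Q by (rule free_over_carrierE)
      have "ext U d \<inter> ext U s = ext U d \<inter> ext U t"
        "(points U - ext U d) \<inter> ext U s = (points U - ext U d) \<inter> ext U t"
        using eq s t d by (simp_all add: h tclass_eq_iff_ext)
      then have "ext U s = ext U t"
        using ext_subset_points[of U s] ext_subset_points[of U t] by blast
      then show "P = Q" using s t by (simp add: tclass_eq_iff_ext)
    qed
    show "h ` ca_univ FX = ca_univ (ca_prod ?A ?B)"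
    proof (intro subset_antisym image_subsetI in_prod subsetI)
      fix R
      assume "R \<in> ca_univ (ca_prod ?A ?B)"
      then have "fst R \<in> ca_univ ?A" "snd R \<in> ca_univ ?B" by (auto simp: ca_prod_def)
      moreover have "tvars (Neg d) \<subseteq> X" using d by simp
      ultimately obtain s t where st: "tvars s \<subseteq> X" "ext U s \<subseteq> ext U d" "fst R = clX s"
          "tvars t \<subseteq> X" "ext U t \<subseteq> ext U (Neg d)" "snd R = clX t"
        using relativize_univE d by metis
      \<comment> \<open>The sum of the components is the preimage of the pair, since they lie on
        opposite sides of \<open>d\<close>.\<close>
      have "ext U (Mul d (Add s t)) = ext U s" "ext U (Mul (Neg d) (Add s t)) = ext U t"
        using st(2,5) ext_subset_points[of U s] by auto
      then have "h (clX (Add s t)) = R"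
        using st d by (simp add: h tclass_eq_iff_ext prod_eq_iff del: ext_simps)
      then show "R \<in> h ` ca_univ FX" using st by (force intro: tclass_in_free_over)
    qed
  qed
  ultimately show ?thesis unfolding ca_iso_def by blast
qed

end


section \<open>The atoms of the free algebra\<close>

context
  fixes U :: "('i \<Rightarrow> 'u) set set" and p q :: 'i and m :: nat
  assumes inf: "infinite (UNIV :: 'i set)" and U: "requires_diagonalization U" and pq: "p \<noteq> q"
begin

abbreviation (input) "F \<equiv> free_over (full_alg ` U) {..<m}"
abbreviation (input) "cls \<equiv> tclass (full_alg ` U) {..<m}"

text \<open>All points of a cell agree on the \<open>m\<close> generators and are isolated, so by
  \<open>isolated_determined\<close> they agree on every term over them.\<close>

lemma cell_decides:
  assumes "tvars t \<subseteq> {..<m}"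
  shows "ext U (cell m p q S) \<subseteq> ext U t \<or> ext U (cell m p q S) \<inter> ext U t = {}"
proof -
  have "P \<in> ext U t \<longleftrightarrow> P' \<in> ext U t"
    if "P \<in> ext U (cell m p q S)" "P' \<in> ext U (cell m p q S)" for P P'
  proof -
    obtain V v f V' v' f' where P: "P = (V, v, f)" "P' = (V', v', f')" by (metis prod_cases3)
    show ?thesis
      using that assms unfolding P by (intro isolated_determined[OF inf U pq]) (auto simp: ext_cell)
  qed
  then show ?thesis by blast
qed

lemma isolated_in_cell:
  assumes "P \<in> ext U (isolated p q)"
  obtains S where "S \<subseteq> {..<m}" "P \<in> ext U (cell m p q S)"
proof -
  obtain V v f where P: "P = (V, v, f)" by (cases P)
  show thesis
    \<comment> \<open>The sign pattern is read off from the generators that contain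
      \<open>f\<close>.\<close>
    using assms unfolding P by (intro that[of "{x. x < m \<and> f \<in> v x}"]) (auto simp: P ext_cell)
qed

lemma ca_atom_cell: "ca_atom F (cls (cell m p q S))"
proof -
  have "ext U s = {} \<or> ext U s = ext U (cell m p q S)"
    if "tvars s \<subseteq> {..<m}" "ext U s \<subseteq> ext U (cell m p q S)" for s
    using cell_decides[OF that(1), of S] that(2) by blast
  then show ?thesis
    using ext_cell_nonempty[OF U, of m p q S] by (simp add: ca_atom_free_over)
qed

text \<open>By \<open>atom_const\<close> the atom consists of isolated points, so it meets some
  cell. Atom and cell decide each other, hence coincide. The bound on \<open>m\<close> supplies the
  generator 0 used by the splitter.\<close>

lemma ca_atom_is_cell:
  assumes m: "m \<ge> 1" and a: "ca_atom F a"
  obtains S where "S \<subseteq> {..<m}" "a = cls (cell m p q S)"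
proof -
  obtain t where t: "tvars t \<subseteq> {..<m}" "a = cls t" "ext U t \<noteq> {}"
    "\<And>s. tvars s \<subseteq> {..<m} \<Longrightarrow> ext U t \<subseteq> ext U s \<or> ext U t \<inter> ext U s = {}"
    using a by (rule ca_atom_free_overE) metis
  have "ext U t \<inter> ext U (nonconst p q) = {}"
    using m a t(1,2) by (intro atom_const[OF inf supports_if_requires[OF U]]) auto
  then have "ext U t \<subseteq> ext U (isolated p q)"
    using ext_subset_points[of U t] by (auto simp: isolated_def)
  then obtain P S where S: "S \<subseteq> {..<m}" "P \<in> ext U t" "P \<in> ext U (cell m p q S)"
    using t(3) isolated_in_cell by (metis all_not_in_conv subsetD)
  then have "ext U t = ext U (cell m p q S)"
    using t(4)[of "cell m p q S"] cell_decides[OF t(1), of S] by auto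
  then show thesis using S t(1,2) that by (simp add: tclass_eq_iff_ext)
qed

lemma card_atoms:
  assumes "m \<ge> 1"
  shows "card {a. ca_atom F a} = 2 ^ m"
proof -
  have "{a. ca_atom F a} = (\<lambda>S. cls (cell m p q S)) ` Pow {..<m}"
  proof (intro equalityI subsetI)
    fix a
    assume "a \<in> {a. ca_atom F a}"
    then have "ca_atom F a" by simp
    then obtain S where "S \<subseteq> {..<m}" "a = cls (cell m p q S)" by (rule ca_atom_is_cell[OF assms])
    then show "a \<in> (\<lambda>S. cls (cell m p q S)) ` Pow {..<m}" by blast
  next
    fix a
    assume "a \<in> (\<lambda>S. cls (cell m p q S)) ` Pow {..<m}"
    then obtain S where "a = cls (cell m p q S)" by (rule imageE)
    then show "a \<in> {a. ca_atom F a}" using ca_atom_cell by simp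
  qed
  moreover have "inj_on (\<lambda>S. cls (cell m p q S)) (Pow {..<m})"
  proof (rule inj_onI)
    fix S T
    assume ST: "S \<in> Pow {..<m}" "T \<in> Pow {..<m}" "cls (cell m p q S) = cls (cell m p q T)"
    then have "ext U (cell m p q S) = ext U (cell m p q T)" by (simp add: tclass_eq_iff_ext)
    then show "S = T"
      using ST cells_meet_iff[OF U, of S m T p q] ext_cell_nonempty[OF U, of m p q T] by auto
  qed
  ultimately show ?thesis by (simp add: card_image card_Pow)
qed

section \<open>The discrete factor below \<open>isolated p q\<close> and its atomless
  complement\<close>

lemma zero_dimensional_below_isolated:
  assumes "tvars t \<subseteq> {..<m}" "ext U t \<subseteq> ext U (isolated p q)"
  shows "zero_dimensional F (cls t)"
  using assms isolated_zero_dim[OF inf U pq assms(2)]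
  by (simp add: zero_dimensional_def free_over_simps tclass_eq_iff_ext)

lemma ext_cells_join:
  assumes "finite \<S>"
  shows "\<exists>t. tvars t \<subseteq> {..<m} \<and> ext U t = (\<Union>S\<in>\<S>. ext U (cell m p q S))"
  using assms
proof (induction \<S>)
  case empty
  then show ?case by (intro exI[of _ Zero]) simp
next
  case (insert S \<S>)
  then obtain t where "tvars t \<subseteq> {..<m}" "ext U t = (\<Union>S\<in>\<S>. ext U (cell m p q S))" by blast
  then show ?case by (intro exI[of _ "Add (cell m p q S) t"]) simp
qed

text \<open>The cells cover the isolated points, and a cell meeting \<open>t\<close> lies inside
  it.\<close>

lemma ext_below_isolated:
  assumes "tvars t \<subseteq> {..<m}" "ext U t \<subseteq> ext U (isolated p q)"
  shows "ext U t = (\<Union>S\<in>{S \<in> Pow {..<m}. ext U (cell m p q S) \<subseteq> ext U t}. ext U (cell m p q S))"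
proof (intro subset_antisym subsetI)
  fix P
  assume P: "P \<in> ext U t"
  then obtain S where S: "S \<subseteq> {..<m}" "P \<in> ext U (cell m p q S)"
    using assms(2) isolated_in_cell by blast
  then have "ext U (cell m p q S) \<subseteq> ext U t" using P cell_decides[OF assms(1), of S] by blast
  with S show "P \<in> (\<Union>S\<in>{S \<in> Pow {..<m}. ext U (cell m p q S) \<subseteq> ext U t}. ext U (cell m p q S))"
    by blast
qed blast

text \<open>The elements of this factor correspond to the sets of cells: \<open>\<phi>\<close> lists
  the cells below an element, \<open>ext_below_isolated\<close> recovers the element from the list,
  and \<open>ext_cells_join\<close> realizes every list.\<close>

lemma card_relativize_isolated:
  "card (ca_univ (relativize F (cls (isolated p q)))) = 2 ^ (2 ^ m)"
proof -
  let ?D = "ca_univ (relativize F (cls (isolated p q)))"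
  define \<phi> where "\<phi> P = {S \<in> Pow {..<m}. ca_le F (cls (cell m p q S)) P}" for P
  have \<phi>: "\<phi> (cls t) = {S \<in> Pow {..<m}. ext U (cell m p q S) \<subseteq> ext U t}" if "tvars t \<subseteq> {..<m}" for t
    using that by (simp add: \<phi>_def ca_le_free_over)
  have iso: "tvars (isolated p q) \<subseteq> {..<m}" by simp
  have "bij_betw \<phi> ?D (Pow (Pow {..<m}))"
  proof (rule bij_betw_imageI)
    show "inj_on \<phi> ?D"
    proof (rule inj_onI)
      fix P Q
      assume P: "P \<in> ?D" and Q: "Q \<in> ?D" and eq: "\<phi> P = \<phi> Q"
      obtain s where s: "tvars s \<subseteq> {..<m}" "ext U s \<subseteq> ext U (isolated p q)" "P = cls s"
        using P by (rule relativize_univE[OF iso])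
      obtain t where t: "tvars t \<subseteq> {..<m}" "ext U t \<subseteq> ext U (isolated p q)" "Q = cls t"
        using Q by (rule relativize_univE[OF iso])
      have "ext U s = ext U t"
        using eq ext_below_isolated[OF s(1,2)] ext_below_isolated[OF t(1,2)] s t by (simp add: \<phi>)
      then show "P = Q" using s t by (simp add: tclass_eq_iff_ext)
    qed
    show "\<phi> ` ?D = Pow (Pow {..<m})"
    proof (intro subset_antisym subsetI)
      fix \<S>
      assume S: "\<S> \<in> Pow (Pow {..<m})"
      then have "finite \<S>" by (auto intro: finite_subset)
      then obtain t where t: "tvars t \<subseteq> {..<m}" "ext U t = (\<Union>S\<in>\<S>. ext U (cell m p q S))"
        using ext_cells_join by blast
      have "cls t \<in> ?D"
      proof (rule relativize_univI[OF iso t(1)])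
        show "ext U t \<subseteq> ext U (isolated p q)"
          unfolding t(2) by (intro UN_least ext_cell_subset)
      qed
      moreover have "\<phi> (cls t) = \<S>"
      proof -
        \<comment> \<open>A cell below the union shares a point with one of the cells joined, and
          distinct cells are disjoint.\<close>
        have "T \<in> \<S>" if T: "T \<subseteq> {..<m}" "ext U (cell m p q T) \<subseteq> ext U t" for T
        proof -
          obtain P where P: "P \<in> ext U (cell m p q T)"
            using ext_cell_nonempty[OF U, of m p q T] by blast
          then obtain S' where S': "S' \<in> \<S>" "P \<in> ext U (cell m p q S')" using T(2) t(2) by blast
          then have "T = S'" using P cells_meet_iff[OF U T(1), of S' p q] S by blast
          then show ?thesis using S'(1) by simp
        qed
        then show ?thesis using S unfolding \<phi>[OF t(1)] t(2) by blast
      qed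
      ultimately show "\<S> \<in> \<phi> ` ?D" by blast
    qed (auto simp: \<phi>_def)
  qed
  then have "card ?D = card (Pow (Pow {..<m}))" by (rule bij_betw_same_card)
  then show ?thesis by (simp add: card_Pow)
qed

lemma ca_discrete_relativize_isolated:
  "ca_discrete (relativize F (cls (isolated p q)))"
  unfolding ca_discrete_def
proof (intro ballI allI)
  fix P i
  assume P: "P \<in> ca_univ (relativize F (cls (isolated p q)))"
  have iso: "tvars (isolated p q) \<subseteq> {..<m}" by simp
  obtain t where t: "tvars t \<subseteq> {..<m}" "ext U t \<subseteq> ext U (isolated p q)" "P = cls t"
    using P by (rule relativize_univE[OF iso])
  have "ca_cyl F i (cls t) = cls t"
    using zero_dimensional_below_isolated[OF t(1,2)] by (simp add: zero_dimensional_def)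
  then show "ca_cyl (relativize F (cls (isolated p q))) i P = P"
    using t by (simp add: free_over_simps tclass_eq_iff_ext Int_absorb1)
qed

text \<open>An atom of this factor would be an atom of the free algebra, thus a nonempty cell, but
  cells consist of isolated points.\<close>

lemma ca_atomless_relativize_nonisolated:
  assumes m: "m \<ge> 1"
  shows "ca_atomless (relativize F (cls (Neg (isolated p q))))"
  unfolding ca_atomless_def
proof
  assume "\<exists>a. ca_atom (relativize F (cls (Neg (isolated p q)))) a"
  then obtain a where a: "ca_atom (relativize F (cls (Neg (isolated p q)))) a" by blast
  have iso: "tvars (Neg (isolated p q)) \<subseteq> {..<m}" by simp
  note at = ca_atom_relativize[OF iso a]
  obtain S where S: "a = cls (cell m p q S)" using m at(1) by (rule ca_atom_is_cell)
  then have "ext U (cell m p q S) \<subseteq> ext U (Neg (isolated p q))"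
    using at(2) iso by (simp add: ca_le_free_over del: ext_simps)
  then show False
    using ext_cell_subset[of U m p q S] ext_cell_nonempty[OF U, of m p q S] by auto
qed

end

section \<open>Transfer from \<open>K\<close> to the full algebras and assembly of the
  claims\<close>

theorem theorem2p3:
  fixes \<U> :: "('i \<Rightarrow> 'u) set set"
    and K :: "('a, 'i) cyl_alg set"
    and m :: nat
  assumes "infinite (UNIV :: 'i set)"
    and "\<forall>A\<in>K. cylindric_type A"
    and "(variety K :: ('i trm set, 'i) cyl_alg set) = variety (full_alg ` \<U>)"
    and "m \<ge> 1"
  shows "(supports_diagonalization \<U> \<and> (\<exists>V\<in>\<U>. \<exists>f\<in>V. \<exists>i j. f i \<noteq> f j)
            \<longrightarrow> \<not> ca_atomic (free_alg m K))
       \<and> (requires_diagonalization \<U>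
            \<longrightarrow> card {a. ca_atom (free_alg m K) a} = 2 ^ m
              \<and> (\<forall>a. ca_atom (free_alg m K) a \<longrightarrow> zero_dimensional (free_alg m K) a)
              \<and> (\<exists>(A :: ('i trm set, 'i) cyl_alg) (B :: ('i trm set, 'i) cyl_alg).
                    cylindric_type A \<and> cylindric_type B
                  \<and> ca_iso (free_alg m K) (ca_prod A B)
                  \<and> card (ca_univ A) = 2 ^ (2 ^ m)
                  \<and> ca_discrete A \<and> ca_atomless B))
       \<and> (\<U> = UNIV \<and> (\<exists>x y :: 'u. x \<noteq> y)
            \<longrightarrow> ca_atomless (free_alg (m - 1) K))"
proof -
  have "identities K = identities (full_alg ` \<U>)"
    using variety_eq_iff[of K "full_alg ` \<U>"] assms(2,3) cylindric_type_full_alg by blast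
  \<comment> \<open>The construction of the free algebra refers to its class only through the
    identities.\<close>
  then have "free_over K X = free_over (full_alg ` \<U>) X" for X
    by (simp add: free_over_def tclass_def)
  then have F: "free_alg n K = free_over (full_alg ` \<U>) {..<n}" for n
    by (simp add: free_alg_def)
  have 0: "0 \<in> {..<m}" using assms(4) by simp
  obtain p :: 'i where True by blast
  obtain q :: 'i where "q \<noteq> p" using ex_new_if_finite[OF assms(1), of "{p}"] by auto
  then have pq: "p \<noteq> q" by simp
  have 1: "\<not> ca_atomic (free_alg m K)"
    if supp: "supports_diagonalization \<U>" and nc: "\<exists>V\<in>\<U>. \<exists>f\<in>V. \<exists>i j. f i \<noteq> f j"
  proof -
    \<comment> \<open>The two indices at which \<open>f\<close> differs become the indices of the
      nonzero element \<open>nonconst i j\<close> with no atom below it.\<close>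
    obtain V f i j where "V \<in> \<U>" "f \<in> V" "f i \<noteq> f j" using nc by blast
    then show ?thesis unfolding F by (rule not_atomic_if_supports[OF assms(1) supp 0])
  qed
  have 3: "ca_atomless (free_alg (m - 1) K)" if all: "\<U> = UNIV" and ne: "\<exists>x y :: 'u. x \<noteq> y"
  proof -
    obtain x y :: 'u where "x \<noteq> y" using ne by blast
    then show ?thesis unfolding F all by (rule atomless_if_all_units[OF assms(1)])
  qed
  have 2: "card {a. ca_atom (free_alg m K) a} = 2 ^ m
      \<and> (\<forall>a. ca_atom (free_alg m K) a \<longrightarrow> zero_dimensional (free_alg m K) a)
      \<and> (\<exists>(A :: ('i trm set, 'i) cyl_alg) (B :: ('i trm set, 'i) cyl_alg).
            cylindric_type A \<and> cylindric_type B \<and> ca_iso (free_alg m K) (ca_prod A B)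
          \<and> card (ca_univ A) = 2 ^ (2 ^ m) \<and> ca_discrete A \<and> ca_atomless B)"
    if U: "requires_diagonalization \<U>"
  proof (intro conjI exI allI impI)
    \<comment> \<open>The factors are the relativizations to the isolated points and to the
      remaining ones.\<close>
    let ?c = "tclass (full_alg ` \<U>) {..<m}"
    let ?A = "relativize (free_alg m K) (?c (isolated p q))"
    let ?B = "relativize (free_alg m K) (?c (Neg (isolated p q)))"
    note U' = assms(1) U pq
    show "card {a. ca_atom (free_alg m K) a} = 2 ^ m"
      unfolding F by (rule card_atoms[OF U' assms(4)])
    show "zero_dimensional (free_alg m K) a" if a: "ca_atom (free_alg m K) a" for a
    proof -
      obtain S where "a = ?c (cell m p q S)"
        using a unfolding F by (rule ca_atom_is_cell[OF U' assms(4)])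
      then show ?thesis
        unfolding F using zero_dimensional_below_isolated[OF U' _ ext_cell_subset] by simp
    qed
    show "cylindric_type ?A" "cylindric_type ?B"
      unfolding F by (simp_all add: cylindric_type_relativize)
    show "ca_iso (free_alg m K) (ca_prod ?A ?B)"
      unfolding F by (intro ca_iso_relativize isolated_zero_dim[OF U']) simp_all
    show "card (ca_univ ?A) = 2 ^ (2 ^ m)"
      unfolding F by (rule card_relativize_isolated[OF U'])
    show "ca_discrete ?A"
      unfolding F by (rule ca_discrete_relativize_isolated[OF U'])
    show "ca_atomless ?B"
      unfolding F by (rule ca_atomless_relativize_nonisolated[OF U' assms(4)])
  qed
  show ?thesis using 1 2 3 by blast
qed

end
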